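(* Let $S_n=P_{n-1}\vee K_1$ be the shell graph on $n\ge 3$ vertices. Then the visibility polynomial of $S_n$ is $$\mathcal{V}(S_n)=(1+x)^{n-1}+x+(n-1)x^2+(2n-5)x^3 .$$
   Context: Graphs are finite, simple, undirected and connected. For $X\subseteq V(G)$, two vertices $u,v\in V(G)$ are $X$-visible if there is a shortest $(u,v)$-path $P$ in $G$ with $V(P)\cap X\subseteq\{u,v\}$. A set $X\subseteq V(G)$ is a mutual-visibility set of $G$ if every pair of vertices of $X$ is $X$-visible (in particular the empty set and singletons are mutual-visibility sets). The visibility polynomial of $G$ is $\mathcal{V}(G)=\sum_{i\ge 0} r_i x^i$, where $r_i$ is the number of mutual-visibility sets of $G$ of cardinality $i$ (so $r_0=1$). The shell graph $S_n$ ($n\ge 3$) is obtained from the cycle $C_n$ by adding $n-3$ chords incident with a common vertex $c$, called the apex; equivalently $S_n=P_{n-1}\vee K_1$ is the join of a path $P_{n-1}$ on $n-1$ vertices with the single vertex $c$. *)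

theory Defs
  imports
    "Graph_Theory.Pair_Digraph"
    "Graph_Theory.Digraph_Component"
    "HOL-Computational_Algebra.Polynomial"
begin

text \<open>
  A finite simple undirected graph is a \<^locale>\<open>pair_graph\<close>: both orientations of every edge
  belong to \<^const>\<open>parcs\<close>. Paths are the library's \<open>apath\<close>s, i.e. arc sequences whose vertices
  are pairwise distinct.
\<close>

definition shortest_path ::
  "'a pair_pre_digraph \<Rightarrow> 'a \<Rightarrow> ('a \<times> 'a) awalk \<Rightarrow> 'a \<Rightarrow> bool" where
  "shortest_path G u p v \<longleftrightarrow>
     pre_digraph.apath (with_proj G) u p v \<and>
     (\<forall>q. pre_digraph.apath (with_proj G) u q v \<longrightarrow> length p \<le> length q)"

definition visible :: "'a pair_pre_digraph \<Rightarrow> 'a set \<Rightarrow> 'a \<Rightarrow> 'a \<Rightarrow> bool" where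
  "visible G X u v \<longleftrightarrow>
     (\<exists>p. shortest_path G u p v \<and>
          set (pre_digraph.awalk_verts (with_proj G) u p) \<inter> X \<subseteq> {u, v})"

definition mutual_visibility_set :: "'a pair_pre_digraph \<Rightarrow> 'a set \<Rightarrow> bool" where
  "mutual_visibility_set G X \<longleftrightarrow>
     X \<subseteq> pverts G \<and> (\<forall>u\<in>X. \<forall>v\<in>X. visible G X u v)"

text \<open>
  For finite \<open>G\<close>, cutting the sum off at the order of \<open>G\<close> loses nothing, as larger sets of
  vertices do not exist. Integer coefficients avoid truncated subtraction in closed forms.
\<close>

definition visibility_poly :: "'a pair_pre_digraph \<Rightarrow> int poly" where
  "visibility_poly G =
     (\<Sum>i\<le>card (pverts G).
        monom (int (card {X. mutual_visibility_set G X \<and> card X = i})) i)"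

definition path_graph :: "nat \<Rightarrow> nat pair_pre_digraph" where
  "path_graph m =
     \<lparr> pverts = {..<m},
       parcs = {(i, j). i < m \<and> j < m \<and> (j = Suc i \<or> i = Suc j)} \<rparr>"

definition complete_graph :: "nat \<Rightarrow> nat pair_pre_digraph" where
  "complete_graph m =
     \<lparr> pverts = {..<m}, parcs = {(i, j). i < m \<and> j < m \<and> i \<noteq> j} \<rparr>"

definition graph_join ::
  "'a pair_pre_digraph \<Rightarrow> 'b pair_pre_digraph \<Rightarrow> ('a + 'b) pair_pre_digraph" where
  "graph_join G H =
     \<lparr> pverts = pverts G <+> pverts H,
       parcs = {(Inl u, Inl v) | u v. (u, v) \<in> parcs G}
             \<union> {(Inr u, Inr v) | u v. (u, v) \<in> parcs H}
             \<union> {(Inl u, Inr v) | u v. u \<in> pverts G \<and> v \<in> pverts H}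
             \<union> {(Inr v, Inl u) | u v. u \<in> pverts G \<and> v \<in> pverts H} \<rparr>"

definition shell_graph :: "nat \<Rightarrow> (nat + nat) pair_pre_digraph" where
  "shell_graph n = graph_join (path_graph (n - 1)) (complete_graph 1)"

lemma pair_graph_path_graph: "pair_graph (path_graph m)"
proof -
  have "finite (parcs (path_graph m))"
    by (rule finite_subset[of _ "{..<m} \<times> {..<m}"]) (auto simp: path_graph_def)
  then show ?thesis
    by unfold_locales (auto simp: path_graph_def symmetric_def sym_def)
qed

lemma pair_graph_complete_graph: "pair_graph (complete_graph m)"
proof -
  have "finite (parcs (complete_graph m))"
    by (rule finite_subset[of _ "{..<m} \<times> {..<m}"]) (auto simp: complete_graph_def)
  then show ?thesis
    by unfold_locales (auto simp: complete_graph_def symmetric_def sym_def)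
qed

lemma pair_graph_graph_join:
  assumes "pair_graph G" and "pair_graph H"
  shows "pair_graph (graph_join G H)"
proof -
  interpret G: pair_graph G by fact
  interpret H: pair_graph H by fact
  have wf: "fst e \<in> pverts (graph_join G H) \<and> snd e \<in> pverts (graph_join G H)"
    if "e \<in> parcs (graph_join G H)" for e
    using that by (auto simp: graph_join_def dest: G.in_arcsD1 G.in_arcsD2 H.in_arcsD1 H.in_arcsD2)
  have finV: "finite (pverts (graph_join G H))"
    using G.pair_finite_verts H.pair_finite_verts by (simp add: graph_join_def)
  have finE: "finite (parcs (graph_join G H))"
    by (rule finite_subset[of _ "pverts (graph_join G H) \<times> pverts (graph_join G H)"])
       (use wf finV in \<open>auto simp: mem_Times_iff\<close>)
  have sym: "symmetric (with_proj (graph_join G H))"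
    using G.pair_sym_arcs H.pair_sym_arcs
    by (auto simp: graph_join_def symmetric_def sym_def)
  have irrefl: "fst e \<noteq> snd e" if "e \<in> parcs (graph_join G H)" for e
    using that by (auto simp: graph_join_def dest: G.no_loops' H.no_loops')
  show ?thesis
    by unfold_locales (use wf finV finE sym irrefl in auto)
qed

lemma pair_graph_shell_graph: "pair_graph (shell_graph n)"
  unfolding shell_graph_def
  by (intro pair_graph_graph_join pair_graph_path_graph pair_graph_complete_graph)

lemma card_pverts_shell_graph: "n \<ge> 1 \<Longrightarrow> card (pverts (shell_graph n)) = n"
  by (simp add: shell_graph_def graph_join_def path_graph_def complete_graph_def card_Plus)

lemma connected_shell_graph: "connected (with_proj (shell_graph n))"
proof -
  let ?G = "with_proj (shell_graph n)"
  interpret pair_graph "shell_graph n" by (rule pair_graph_shell_graph)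
  have c: "Inr 0 \<in> pverts (shell_graph n)"
    by (auto simp: shell_graph_def graph_join_def complete_graph_def)
  have adj: "u = Inr 0 \<or> (u, Inr 0) \<in> parcs (shell_graph n) \<and> (Inr 0, u) \<in> parcs (shell_graph n)"
    if "u \<in> pverts (shell_graph n)" for u
    using that by (auto simp: shell_graph_def graph_join_def complete_graph_def)
  have "u \<rightarrow>\<^sup>*\<^bsub>?G\<^esub> Inr 0 \<and> Inr 0 \<rightarrow>\<^sup>*\<^bsub>?G\<^esub> u" if "u \<in> pverts (shell_graph n)" for u
    using adj[OF that] c by (auto intro: reachable_adjI)
  then have reach: "u \<rightarrow>\<^sup>*\<^bsub>?G\<^esub> v"
    if "u \<in> pverts (shell_graph n)" "v \<in> pverts (shell_graph n)" for u v
    using that by (blast intro: reachable_trans)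
  have "pverts (mk_symmetric ?G) = pverts (shell_graph n)"
    by (simp add: mk_symmetric_def)
  then show ?thesis
    using c reach reachable_mk_symmetric_eq[OF pair_sym_arcs]
    unfolding connected_def strongly_connected_def by auto
qed

end

theory Submission
  imports Defs
begin

text \<open>
  Any two non-adjacent vertices of the path are at distance two through the apex, so every set
  avoiding the apex is a mutual-visibility set; these contribute \<open>(1 + x) ^ (n - 1)\<close>. If the apex
  belongs to the set, two path vertices of it can see each other only along the path, which forces
  them to be adjacent, or at path distance two with the vertex between them outside the set.
  Hence there are at most two of them: no path vertex gives \<open>x\<close>, one gives \<open>(n - 1) x ^ 2\<close>, and
  two give \<open>((n - 2) + (n - 3)) x ^ 3\<close>.
\<close>

lemma visible_refl:
  assumes "pair_graph G" "u \<in> pverts G"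
  shows "visible G X u u"
proof -
  interpret pair_graph G by fact
  have "apath u [] u"
    using assms by (simp add: apath_Nil_iff)
  then show ?thesis
    unfolding visible_def shortest_path_def by (intro exI[of _ "[]"]) auto
qed

text \<open>A single arc has no interior vertex, so no set \<open>X\<close> can block it, and
  distinct ends rule out the empty path as a shorter one.\<close>

lemma visible_adjacent:
  assumes "pair_graph G" "(u, v) \<in> parcs G"
  shows "visible G X u v"
proof -
  interpret pair_graph G by fact
  have "u \<noteq> v" "u \<in> pverts G" "v \<in> pverts G"
    using assms no_loops' in_arcsD1 in_arcsD2 by auto
  then have "apath u [(u, v)] v"
    using assms by (auto simp: apath_Cons_iff apath_Nil_iff)
  moreover have "q \<noteq> []" if "apath u q v" for q
    using that \<open>u \<noteq> v\<close> by (auto simp: apath_Nil_iff)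
  ultimately show ?thesis
    unfolding visible_def shortest_path_def
    by (intro exI[of _ "[(u, v)]"]) (auto simp: Suc_le_eq)
qed

text \<open>The ends are at distance exactly two: \<open>w\<close> witnesses a path of length two,
  while distinctness and non-adjacency exclude anything shorter. The shortest paths thus correspond
  to the common neighbours, and \<open>X\<close> blocks such a path exactly when it contains the
  middle vertex.\<close>

lemma visible_iff_common_neighbour:
  assumes "pair_graph G" "u \<noteq> v" "(u, v) \<notin> parcs G"
    and "(u, w) \<in> parcs G" "(w, v) \<in> parcs G"
  shows "visible G X u v \<longleftrightarrow> (\<exists>w. (u, w) \<in> parcs G \<and> (w, v) \<in> parcs G \<and> w \<notin> X)"
proof -
  interpret pair_graph G by fact
  have two: "apath u [(u, x), (x, v)] v" if "(u, x) \<in> parcs G" "(x, v) \<in> parcs G" for x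
    using that assms(2) in_arcsD1[OF that(1)] in_arcsD2[OF that(2)] in_arcsD1[OF that(2)]
      no_loops'[OF that(1)] no_loops'[OF that(2)]
    by (auto simp: apath_Cons_iff apath_Nil_iff)
  have ge: "2 \<le> length q" if "apath u q v" for q
  proof (rule ccontr)
    assume "\<not> 2 \<le> length q"
    then consider "q = []" | e where "q = [e]"
      by (cases q; cases "tl q") auto
    then show False
      using that assms(2,3) by cases (auto simp: apath_Nil_iff apath_Cons_iff)
  qed
  have short: "shortest_path G u p v \<longleftrightarrow>
      (\<exists>x. (u, x) \<in> parcs G \<and> (x, v) \<in> parcs G \<and> p = [(u, x), (x, v)])" for p
  proof
    assume p: "shortest_path G u p v"
    then have "length p \<le> 2" and ap: "apath u p v"
      using two[OF assms(4,5)] by (auto simp: shortest_path_def)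
    with ge have "length p = 2" by (simp add: le_antisym)
    then obtain e f where "p = [e, f]"
      by (auto simp: numeral_2_eq_2 length_Suc_conv)
    with ap show "\<exists>x. (u, x) \<in> parcs G \<and> (x, v) \<in> parcs G \<and> p = [(u, x), (x, v)]"
      by (cases e; cases f) (auto simp: apath_Nil_iff apath_Cons_iff)
  next
    assume "\<exists>x. (u, x) \<in> parcs G \<and> (x, v) \<in> parcs G \<and> p = [(u, x), (x, v)]"
    then show "shortest_path G u p v"
      using two ge by (auto simp: shortest_path_def numeral_2_eq_2)
  qed
  \<comment> \<open>Absence of loops makes the middle vertex differ from both ends, so the exception
    for \<open>{u, v}\<close> in \<open>visible\<close> cannot excuse it.\<close>
  show ?thesis
    unfolding visible_def short using no_loops' by fastforce
qed

text \<open>Grouping the sets by cardinality recovers the coefficients. The ungrouped form lets the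
  family be split by membership of the apex.\<close>

lemma visibility_poly_eq_sum:
  assumes "finite (pverts G)"
  shows "visibility_poly G = (\<Sum>X | mutual_visibility_set G X. monom 1 (card X))"
proof -
  let ?M = "{X. mutual_visibility_set G X}"
  have fin: "finite ?M"
    by (rule finite_subset[of _ "Pow (pverts G)"])
      (use assms in \<open>auto simp: mutual_visibility_set_def\<close>)
  have "card X \<le> card (pverts G)" if "X \<in> ?M" for X
    using that assms by (auto simp: mutual_visibility_set_def intro: card_mono)
  then have "(\<Sum>X\<in>?M. monom (1::int) (card X)) =
      (\<Sum>i\<le>card (pverts G). \<Sum>X | X \<in> ?M \<and> card X = i. monom 1 (card X))"
    by (intro sum.group[symmetric] fin) auto
  also have "\<dots> = visibility_poly G"
    unfolding visibility_poly_def
    by (intro sum.cong refl) (simp add: of_nat_poly smult_monom)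
  finally show ?thesis ..
qed

lemma sum_Pow_monom_card:
  assumes "finite A"
  shows "(\<Sum>X\<in>Pow A. monom (1::'a::comm_semiring_1) (card X)) = (1 + [:0, 1:]) ^ card A"
proof -
  have "(1 + [:0, 1:]) ^ card A = (\<Prod>a\<in>A. [:0, 1:] + (1::'a poly))"
    by (simp add: add.commute)
  \<comment> \<open>Expanding the product chooses, for each \<open>a\<close>, either the variable or
    1; the subset \<open>X\<close> records where the variable was chosen.\<close>
  also have "\<dots> = (\<Sum>X\<in>Pow A. [:0, 1:] ^ card X)"
    by (subst prod_add[OF assms]) simp
  finally show ?thesis
    by (simp add: monom_altdef)
qed

lemma arcs_shell_graph:
  "(Inl i, Inl j) \<in> parcs (shell_graph n) \<longleftrightarrow> i < n - 1 \<and> j < n - 1 \<and> (j = Suc i \<or> i = Suc j)"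
  "(Inl i, Inr k) \<in> parcs (shell_graph n) \<longleftrightarrow> i < n - 1 \<and> k = 0"
  "(Inr k, Inl i) \<in> parcs (shell_graph n) \<longleftrightarrow> i < n - 1 \<and> k = 0"
  "(Inr k, Inr l) \<notin> parcs (shell_graph n)"
  by (auto simp: shell_graph_def graph_join_def path_graph_def complete_graph_def)

lemma verts_shell_graph:
  "pverts (shell_graph n) = insert (Inr 0) (Inl ` {..<n - 1})"
  by (auto simp: shell_graph_def graph_join_def path_graph_def complete_graph_def)

text \<open>Non-adjacent path vertices have the apex as a common neighbour, and also the vertex
  between them when their path distance is two; there is no other. Both orders appear because
  \<open>visible\<close> takes an ordered pair.\<close>

lemma visible_shell_graph_Inl:
  assumes "i < j" "j < n - 1"
  shows "visible (shell_graph n) X (Inl i) (Inl j) \<longleftrightarrow>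
           Inr 0 \<notin> X \<or> j = Suc i \<or> j = Suc (Suc i) \<and> Inl (Suc i) \<notin> X" (is ?A)
    and "visible (shell_graph n) X (Inl j) (Inl i) \<longleftrightarrow>
           Inr 0 \<notin> X \<or> j = Suc i \<or> j = Suc (Suc i) \<and> Inl (Suc i) \<notin> X" (is ?B)
proof -
  let ?S = "shell_graph n"
  let ?vis = "visible ?S X"
  note adj = visible_adjacent[OF pair_graph_shell_graph[of n]]
  have common:
    "(Inl i, w) \<in> parcs ?S \<and> (w, Inl j) \<in> parcs ?S \<longleftrightarrow>
       w = Inr 0 \<or> j = Suc (Suc i) \<and> w = Inl (Suc i)"
    "(Inl j, w) \<in> parcs ?S \<and> (w, Inl i) \<in> parcs ?S \<longleftrightarrow>
       w = Inr 0 \<or> j = Suc (Suc i) \<and> w = Inl (Suc i)" for w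
    using assms by (cases w; auto simp: arcs_shell_graph)+
  \<comment> \<open>The apex serves as the common neighbour that fixes the distance at two.\<close>
  note nonadj = visible_iff_common_neighbour[OF pair_graph_shell_graph[of n], where w = "Inr 0"]
  have "?A \<and> ?B"
  proof (cases "j = Suc i")
    case True
    then show ?thesis using assms by (simp add: adj arcs_shell_graph)
  next
    case False
    have "?vis (Inl i) (Inl j) \<longleftrightarrow>
        (\<exists>w. ((Inl i, w) \<in> parcs ?S \<and> (w, Inl j) \<in> parcs ?S) \<and> w \<notin> X)"
      "?vis (Inl j) (Inl i) \<longleftrightarrow>
        (\<exists>w. ((Inl j, w) \<in> parcs ?S \<and> (w, Inl i) \<in> parcs ?S) \<and> w \<notin> X)"
      using assms False by (simp_all add: nonadj arcs_shell_graph)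
    with False show ?thesis
      unfolding common by auto
  qed
  then show ?A ?B by auto
qed

text \<open>The apex is adjacent to every path vertex, so pairs containing it never impose a
  condition; only pairs of path vertices remain.\<close>

lemma mutual_visibility_set_shell_graph:
  "mutual_visibility_set (shell_graph n) X \<longleftrightarrow>
     X \<subseteq> pverts (shell_graph n) \<and>
     (Inr 0 \<in> X \<longrightarrow>
       (\<forall>i j. Inl i \<in> X \<longrightarrow> Inl j \<in> X \<longrightarrow> i < j \<longrightarrow>
          j = Suc i \<or> j = Suc (Suc i) \<and> Inl (Suc i) \<notin> X))"
    (is "_ \<longleftrightarrow> _ \<and> (_ \<longrightarrow> ?close)")
proof (cases "X \<subseteq> pverts (shell_graph n)")
  case True
  let ?vis = "visible (shell_graph n) X"
  have lt: "i < n - 1" if "Inl i \<in> X" for i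
    using True that by (auto simp: verts_shell_graph)
  have zero: "k = 0" if "Inr k \<in> X" for k
    using True that by (auto simp: verts_shell_graph)
  note refl = visible_refl[OF pair_graph_shell_graph[of n]]
  note adj = visible_adjacent[OF pair_graph_shell_graph[of n]]
  have apex: "?vis (Inr 0) (Inr 0)" "Inl i \<in> X \<Longrightarrow> ?vis (Inl i) (Inr 0)"
    "Inl i \<in> X \<Longrightarrow> ?vis (Inr 0) (Inl i)" for i
    using lt[of i] refl[where X = X and u = "Inr 0"]
      adj[where X = X and u = "Inl i" and v = "Inr 0"]
      adj[where X = X and u = "Inr 0" and v = "Inl i"]
    by (simp_all add: verts_shell_graph arcs_shell_graph)
  have vis: "?vis (Inl i) (Inl j) \<and> ?vis (Inl j) (Inl i) \<longleftrightarrow>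
      Inr 0 \<notin> X \<or> j = Suc i \<or> j = Suc (Suc i) \<and> Inl (Suc i) \<notin> X"
    if "Inl i \<in> X" "Inl j \<in> X" "i < j" for i j
    using visible_shell_graph_Inl[OF that(3) lt[OF that(2)]] by simp
  have "(\<forall>u\<in>X. \<forall>v\<in>X. ?vis u v) \<longleftrightarrow>
      (\<forall>i j. Inl i \<in> X \<longrightarrow> Inl j \<in> X \<longrightarrow> i < j \<longrightarrow> ?vis (Inl i) (Inl j) \<and> ?vis (Inl j) (Inl i))"
    (is "?L \<longleftrightarrow> ?R")
  proof (intro iffI ballI)
    fix u v assume R: ?R and uX: "u \<in> X" and vX: "v \<in> X"
    show "?vis u v"
    proof (cases u; cases v)
      fix i j assume "u = Inl i" "v = Inl j"
      \<comment> \<open>Pairs with \<open>i < j\<close> suffice: equal indices fall to reflexivity,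
        and \<open>i > j\<close> to the second conjunct of \<open>?R\<close>.\<close>
      with R uX vX True show ?thesis
        by (cases i j rule: linorder_cases) (auto intro!: refl)
    qed (use uX vX in \<open>auto dest!: zero intro: apex\<close>)
  qed auto
  also have "\<dots> \<longleftrightarrow> (Inr 0 \<in> X \<longrightarrow> ?close)"
    using vis by blast
  finally show ?thesis
    using True by (simp add: mutual_visibility_set_def)
qed (simp add: mutual_visibility_set_def)

text \<open>Comparing every path index with the smallest one, \<open>i\<close>, leaves only
  \<open>Suc i\<close> and \<open>Suc (Suc i)\<close> as further candidates, and these two exclude
  each other. For small \<open>n\<close> the truncated bounds merely make ranges empty.\<close>

lemma apex_mutual_visibility_sets_shell_graph:
  "{X. mutual_visibility_set (shell_graph n) X \<and> Inr 0 \<in> X} =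
     {{Inr 0}} \<union> (\<lambda>i. {Inr 0, Inl i}) ` {..<n - 1} \<union>
     ((\<lambda>i. {Inr 0, Inl i, Inl (Suc i)}) ` {..<n - 2} \<union>
      (\<lambda>i. {Inr 0, Inl i, Inl (Suc (Suc i))}) ` {..<n - 3})" (is "?L = ?R")
proof (intro equalityI subsetI)
  fix X assume X: "X \<in> ?L"
  define Y where "Y = {i. Inl i \<in> X}"
  have XY: "X = insert (Inr 0) (Inl ` Y)" and Yn: "Y \<subseteq> {..<n - 1}"
    using X by (auto simp: Y_def mutual_visibility_set_def verts_shell_graph)
  have close: "j = Suc i \<or> j = Suc (Suc i) \<and> Suc i \<notin> Y" if "i \<in> Y" "j \<in> Y" "i < j" for i j
    using X that unfolding mutual_visibility_set_shell_graph Y_def by blast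
  show "X \<in> ?R"
  proof (cases "Y = {}")
    case False
    define i where "i = Min Y"
    have "finite Y" using Yn finite_subset by blast
    then have i: "i \<in> Y" "\<And>j. j \<in> Y \<Longrightarrow> i \<le> j"
      using False by (auto simp: i_def)
    have "Y = {i} \<or> Y = {i, Suc i} \<or> Y = {i, Suc (Suc i)}"
    proof (cases "Suc i \<in> Y")
      case True
      then have "j \<in> {i, Suc i}" if "j \<in> Y" for j
        using i(2)[OF that] close[OF i(1) that] by (auto simp: le_less)
      with True i(1) show ?thesis by blast
    next
      case False
      then have "j \<in> {i, Suc (Suc i)}" if "j \<in> Y" for j
        using i(2)[OF that] close[OF i(1) that] that by (auto simp: le_less)
      with i(1) show ?thesis by blast
    qed
    \<comment> \<open>The bounds on \<open>i\<close> express that the largest index of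
      \<open>Y\<close> is below \<open>n - 1\<close>.\<close>
    then consider "X = {Inr 0, Inl i}" "i < n - 1"
      | "X = {Inr 0, Inl i, Inl (Suc i)}" "i < n - 2"
      | "X = {Inr 0, Inl i, Inl (Suc (Suc i))}" "i < n - 3"
      using Yn unfolding XY by fastforce
    then show ?thesis
      by cases blast+
  qed (simp add: XY)
next
  fix X assume "X \<in> ?R"
  then show "X \<in> ?L"
    by (auto simp: mutual_visibility_set_shell_graph verts_shell_graph)
qed

theorem theorem13:
  fixes n :: nat
  assumes "n \<ge> 3"
  shows "visibility_poly (shell_graph n) =
           (1 + [:0, 1:]) ^ (n - 1) + [:0, 1:]
           + smult (int n - 1) ([:0, 1:] ^ 2)
           + smult (2 * int n - 5) ([:0, 1:] ^ 3)"
proof -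
  let ?S = "shell_graph n"
  let ?w = "\<lambda>X :: (nat + nat) set. monom (1::int) (card X)"
  let ?A = "{X. mutual_visibility_set ?S X \<and> Inr 0 \<notin> X}"
  let ?B = "{X. mutual_visibility_set ?S X \<and> Inr 0 \<in> X}"
  let ?f = "\<lambda>i. {Inr 0, Inl i} :: (nat + nat) set"
  let ?g = "\<lambda>i. {Inr 0, Inl i, Inl (Suc i)} :: (nat + nat) set"
  let ?h = "\<lambda>i. {Inr 0, Inl i, Inl (Suc (Suc i))} :: (nat + nat) set"
  have A: "?A = Pow (Inl ` {..<n - 1})"
    by (auto simp: mutual_visibility_set_shell_graph verts_shell_graph)
  have B: "?B = {{Inr 0}} \<union> ?f ` {..<n - 1} \<union> (?g ` {..<n - 2} \<union> ?h ` {..<n - 3})"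
    by (rule apex_mutual_visibility_sets_shell_graph)
  have sumA: "sum ?w ?A = (1 + [:0, 1:]) ^ (n - 1)"
    unfolding A by (subst sum_Pow_monom_card) (auto simp: card_image)
  have inj: "inj_on ?f I" "inj_on ?g I" "inj_on ?h I" for I
    by (auto simp: inj_on_def doubleton_eq_iff insert_eq_iff)
  \<comment> \<open>The members have cardinality 1, 2 and 3 respectively, which separates the
    families.\<close>
  have "({{Inr 0}} \<union> ?f ` {..<n - 1}) \<inter> (?g ` {..<n - 2} \<union> ?h ` {..<n - 3}) = {}"
    "{{Inr 0}} \<inter> ?f ` {..<n - 1} = {}"
    by (auto dest!: arg_cong[where f = card])
  \<comment> \<open>Both families consist of three-element sets, so here the gap between the two
    path indices, 1 against 2, has to tell them apart.\<close>
  moreover have "?g ` {..<n - 2} \<inter> ?h ` {..<n - 3} = {}"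
    by (auto simp: insert_eq_iff doubleton_eq_iff)
  ultimately have "sum ?w ?B =
      monom 1 1 + of_nat (n - 1) * monom 1 2 + of_nat ((n - 2) + (n - 3)) * monom 1 3"
    unfolding B
    by (simp add: sum.union_disjoint sum.reindex inj o_def numeral_eq_Suc algebra_simps)
  \<comment> \<open>Since \<open>n \<ge> 3\<close>, no natural subtraction is truncated, and
    \<open>(n - 2) + (n - 3)\<close> becomes \<open>2 * int n - 5\<close>.\<close>
  also have "\<dots> =
      [:0, 1:] + smult (int n - 1) ([:0, 1:] ^ 2) + smult (2 * int n - 5) ([:0, 1:] ^ 3)"
    using assms by (simp add: monom_altdef of_nat_poly of_nat_diff)
  finally have sumB: "sum ?w ?B = \<dots>" .
  have "finite (pverts ?S)" by (simp add: verts_shell_graph)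
  then have fin: "finite ?A" "finite ?B"
    unfolding A B by auto
  have "{X. mutual_visibility_set ?S X} = ?A \<union> ?B" "?A \<inter> ?B = {}" by auto
  with visibility_poly_eq_sum[OF \<open>finite (pverts ?S)\<close>] fin
  have "visibility_poly ?S = sum ?w ?A + sum ?w ?B"
    by (simp add: sum.union_disjoint)
  then show ?thesis
    unfolding sumA sumB by (simp add: add.assoc)
qed

end
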